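(* Let $(X,d)$ be a finite ultrametric space with $n=|X|\ge 2$, and let $(G,\omega_d)$ be the associated complete weighted graph. Then the following statements are equivalent: (i) $(X,d)\in\mathfrak{R}$; (ii) the graph $(G,\omega_d)$ has a Hamiltonian path $P=(x_1,\dots,x_n)$ such that $\omega_d(\{x_k,x_{k+1}\})>\omega_d(\{x_{k+1},x_{k+2}\})$ for $k=1,\dots,n-2$; (iii) the graph $(G,\omega_d)$ has a spanning star $S$ with $E(S)=\{\{y_0,y_1\},\dots,\{y_0,y_{n-1}\}\}$ such that $\omega_d(\{y_0,y_i\})\neq\omega_d(\{y_0,y_j\})$ for distinct $i,j\in\{1,\dots,n-1\}$.
   Context: An ultrametric space is a metric space with $d(x,y)\le\max\{d(x,z),d(z,y)\}$ for all $x,y,z$. $\operatorname{Iso}(X)$ is the group of isometries of $(X,d)$ (bijective distance-preserving maps $X\to X$), and $\operatorname{Fix}(g)=\{x\in X: g(x)=x\}$. $\mathfrak{R}$ denotes the class of all finite ultrametric spaces $(X,d)$ with $\min_{g\in \operatorname{Iso}(X)}|\operatorname{Fix}(g)|=|X|-2$. $(G,\omega_d)$ is the complete graph $G$ with vertex set $V(G)=X$ and edge weights $\omega_d(\{x,y\})=d(x,y)$ for distinct $x,y\in X$. A Hamiltonian path is a path visiting every vertex exactly once; $(x_1,\dots,x_n)$ is the path with edges $\{x_k,x_{k+1}\}$. A star is a complete bipartite graph $K_{1,m}$; a spanning star is a star subgraph containing all the vertices of $G$. *)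

theory Defs
  imports
    "HOL-Analysis.Abstract_Metric_Spaces"
    "HOL-Combinatorics.Permutations"
    "Graph_Theory.Graph_Theory"
begin

locale Ultrametric_space = Metric_space X d
  for X :: "'a set" and d :: "'a \<Rightarrow> 'a \<Rightarrow> real" +
  assumes ultra: "\<lbrakk>x \<in> X; y \<in> X; z \<in> X\<rbrakk> \<Longrightarrow> d x y \<le> max (d x z) (d z y)"

(* Bijections of X onto itself are represented by permutations, i.e. they are extended by the
   identity outside X, so that each isometry of X corresponds to exactly one function. *)
definition Iso :: "'a set \<Rightarrow> ('a \<Rightarrow> 'a \<Rightarrow> real) \<Rightarrow> ('a \<Rightarrow> 'a) set" where
  "Iso X d = {g. g permutes X \<and> (\<forall>x\<in>X. \<forall>y\<in>X. d (g x) (g y) = d x y)}"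

definition Fix :: "'a set \<Rightarrow> ('a \<Rightarrow> 'a) \<Rightarrow> 'a set" where
  "Fix X g = {x \<in> X. g x = x}"

(* The difference is taken in the integers: it is negative when X has fewer than two points. *)
definition class_R :: "('a set \<times> ('a \<Rightarrow> 'a \<Rightarrow> real)) set" where
  "class_R = {(X, d). Ultrametric_space X d \<and> finite X \<and>
     int (Min ((\<lambda>g. card (Fix X g)) ` Iso X d)) = int (card X) - 2}"

lemma finite_Iso: "finite X \<Longrightarrow> finite (Iso X d)"
  unfolding Iso_def using finite_permutations[of X] by (rule rev_finite_subset) auto

lemma id_in_Iso: "id \<in> Iso X d"
  by (simp add: Iso_def permutes_id)

(* An undirected graph is a symmetric digraph: each edge {u, v} is the pair of opposite arcs
   (u, v) and (v, u). *)
definition complete_graph_on :: "'a set \<Rightarrow> ('a, 'a \<times> 'a) pre_digraph" where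
  "complete_graph_on X = with_proj \<lparr>pverts = X, parcs = {(x, y). x \<in> X \<and> y \<in> X \<and> x \<noteq> y}\<rparr>"

definition undirected_edges :: "('a, 'b) pre_digraph \<Rightarrow> 'a set set" where
  "undirected_edges G = (\<lambda>(u, v). {u, v}) ` arcs_ends G"

(* Well defined on two-element sets when d is symmetric; see edge_weight_doubleton. *)
definition edge_weight :: "('a \<Rightarrow> 'a \<Rightarrow> real) \<Rightarrow> 'a set \<Rightarrow> real" where
  "edge_weight d e = (THE r. \<exists>x y. x \<noteq> y \<and> e = {x, y} \<and> r = d x y)"

lemma (in Metric_space) edge_weight_doubleton:
  assumes "x \<noteq> y"
  shows "edge_weight d {x, y} = d x y"
  unfolding edge_weight_def
proof (rule the_equality)
  show "\<exists>x' y'. x' \<noteq> y' \<and> {x, y} = {x', y'} \<and> d x y = d x' y'"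
    using assms by blast
next
  fix r assume "\<exists>x' y'. x' \<noteq> y' \<and> {x, y} = {x', y'} \<and> r = d x' y'"
  then show "r = d x y"
    by (auto simp: doubleton_eq_iff commute)
qed

lemma complete_graph_on_complete:
  assumes "finite X"
  shows "K\<^bsub>card X\<^esub> (complete_graph_on X)"
  using assms by (auto simp: complete_graph_on_def complete_digraph_pair_def)

definition hamiltonian_path :: "('a, 'b) pre_digraph \<Rightarrow> 'a list \<Rightarrow> bool" where
  "hamiltonian_path G xs \<longleftrightarrow> vpath xs G \<and> set xs = verts G"

definition star :: "('a, 'b) pre_digraph \<Rightarrow> bool" where
  "star S \<longleftrightarrow> (\<exists>m\<ge>1. K\<^bsub>1,m\<^esub> S)"

definition spanning_star :: "('a, 'b) pre_digraph \<Rightarrow> ('a, 'b) pre_digraph \<Rightarrow> bool" where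
  "spanning_star S G \<longleftrightarrow> star S \<and> spanning S G"

end

(* Each of the three conditions is equivalent to the existence of a centre c whose distances
   to the points of X are pairwise different.

   Two points that are nearest neighbours of each other can be exchanged by an isometry, and every
   closed ball with at least two points contains such a pair. If every isometry moves at most two
   points, the pair {c, p} is unique, since otherwise two exchanges compose to an isometry moving
   three points. So every ball with at least two points contains c, which means that c is a nearest
   point of every other point; two points at the same distance from c would be a second pair.
   Conversely, for a centre c with nearest point p, the distance to a nearest neighbour is an
   invariant that separates all points except c and p.

   The path of (ii) runs through X by decreasing distance from the centre, which is its last
   vertex; the star of (iii) is the star at the centre. *)

theory Submission
  imports Defs
begin

context Ultrametric_space
begin

section \<open>Isosceles triangles and exchangeable points\<close>

lemma isosceles:
  assumes "x \<in> X" "y \<in> X" "c \<in> X" "d c y < d c x"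
  shows "d x y = d c x"
proof -
  have "d x y \<le> max (d c x) (d c y)"
    using ultra[of x y c] assms by (simp add: commute)
  moreover have "d c x \<le> max (d x y) (d c y)"
    using ultra[of x c y] assms by (simp add: commute)
  ultimately show ?thesis
    using assms(4) by linarith
qed

text \<open>For distinct points of an ultrametric space this is equivalent to their transposition
  being an isometry; \<open>transpose_in_Iso\<close> is the direction used below.\<close>

definition mutually_nearest :: "'a \<Rightarrow> 'a \<Rightarrow> bool" where
  "mutually_nearest u v \<longleftrightarrow> u \<in> X \<and> v \<in> X \<and> u \<noteq> v \<and>
     (\<forall>w\<in>X. (w \<noteq> u \<longrightarrow> d u v \<le> d u w) \<and> (w \<noteq> v \<longrightarrow> d u v \<le> d v w))"

lemma mutually_nearest_sym: "mutually_nearest u v \<Longrightarrow> mutually_nearest v u"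
  by (auto simp: mutually_nearest_def commute)

text \<open>Since \<open>d u v\<close> exceeds neither of the two other sides, the strong triangle
  inequality bounds each of these by the other.\<close>

lemma mutually_nearest_dist_eq:
  assumes "mutually_nearest u v" "w \<in> X" "w \<noteq> u" "w \<noteq> v"
  shows "d u w = d v w"
proof -
  have "u \<in> X" "v \<in> X" and le: "d u v \<le> d u w" "d u v \<le> d v w"
    using assms by (auto simp: mutually_nearest_def)
  then have "d u w \<le> max (d u v) (d v w)" "d v w \<le> max (d v u) (d u w)"
    using ultra[of u w v] ultra[of v w u] assms(2) by simp_all
  with le show ?thesis
    using commute[of u v] by auto
qed

lemma transpose_in_Iso:
  assumes "mutually_nearest u v"
  shows "Transposition.transpose u v \<in> Iso X d"
proof -
  have uv: "u \<in> X" "v \<in> X" using assms by (auto simp: mutually_nearest_def)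
  have eq: "d u w = d v w" "d w u = d w v" if "w \<in> X" "w \<noteq> u" "w \<noteq> v" for w
    using mutually_nearest_dist_eq[OF assms that] by (simp_all add: commute)
  have "d (Transposition.transpose u v x) (Transposition.transpose u v y) = d x y"
    if "x \<in> X" "y \<in> X" for x y
  proof -
    consider "x \<in> {u, v}" "y \<in> {u, v}" | "x \<in> {u, v}" "y \<notin> {u, v}"
      | "x \<notin> {u, v}" "y \<in> {u, v}" | "x \<notin> {u, v}" "y \<notin> {u, v}"
      by blast
    then show ?thesis
    proof cases
      case 1
      then show ?thesis using uv commute[of v u] mdist_zero by auto
    next
      case 2
      then show ?thesis using eq(1)[of y] that by auto
    next
      case 3
      then show ?thesis using eq(2)[of x] that by auto
    qed auto
  qed
  moreover have "Transposition.transpose u v permutes X"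
    using uv by (rule permutes_swap_id)
  ultimately show ?thesis
    by (simp add: Iso_def)
qed

lemma Iso_comp:
  assumes "g \<in> Iso X d" "h \<in> Iso X d"
  shows "g \<circ> h \<in> Iso X d"
proof -
  have "h x \<in> X" if "x \<in> X" for x
    using assms(2) that permutes_in_image[of h X x] by (auto simp: Iso_def)
  then show ?thesis
    using assms by (auto simp: Iso_def intro: permutes_compose)
qed

text \<open>Take two distinct points at minimal distance within the closed ball about
  \<open>z\<close> of radius \<open>d z w\<close>; no point outside the ball can be nearer to either
  of them.\<close>

lemma mutually_nearest_in_ball:
  assumes "finite X" "z \<in> X" "w \<in> X" "z \<noteq> w"
  obtains u v where "mutually_nearest u v" "d z u \<le> d z w" "d z v \<le> d z w"
proof -
  define B where "B = {x \<in> X. d z x \<le> d z w}"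
  define P where "P = {(u, v). u \<in> B \<and> v \<in> B \<and> u \<noteq> v}"
  have "P \<subseteq> X \<times> X" by (auto simp: P_def B_def)
  with assms(1) have "finite P" by (meson finite_SigmaI finite_subset)
  moreover have "(z, w) \<in> P" using assms by (auto simp: P_def B_def mdist_zero)
  ultimately obtain q where q: "q \<in> P" "\<And>r. r \<in> P \<Longrightarrow> (case q of (u, v) \<Rightarrow> d u v) \<le> (case r of (u, v) \<Rightarrow> d u v)"
    using ex_is_arg_min_if_finite[of P "\<lambda>(u, v). d u v"]
    by (auto simp: is_arg_min_linorder)
  obtain u v where uv: "q = (u, v)" by fastforce
  then have B: "u \<in> B" "v \<in> B" "u \<noteq> v" and X: "u \<in> X" "v \<in> X"
    and min: "\<And>u' v'. u' \<in> B \<Longrightarrow> v' \<in> B \<Longrightarrow> u' \<noteq> v' \<Longrightarrow> d u v \<le> d u' v'"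
    using q by (force simp: P_def B_def)+
  have uvle: "d u v \<le> d z w"
    using min[of z w] assms by (auto simp: B_def)
  have near: "d u v \<le> d x y" if "x \<in> B" "y \<in> X" "y \<noteq> x" for x y
  proof (cases "y \<in> B")
    case True
    then show ?thesis using min that by auto
  next
    case False
    \<comment> \<open>Here \<open>d z x \<le> d z w < d z y\<close>, which leaves
      \<open>d z y \<le> d x y\<close> and so \<open>d u v \<le> d z w < d x y\<close>.\<close>
    have "d z y \<le> max (d z x) (d x y)"
      using ultra[of z y x] assms that by (auto simp: B_def)
    then show ?thesis using False that uvle by (auto simp: B_def)
  qed
  have "mutually_nearest u v"
    using near B X by (auto simp: mutually_nearest_def)
  then show thesis using B that by (auto simp: B_def)
qed

section \<open>From isometries with few moved points to a centre\<close>

lemma mutually_nearest_unique: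
  assumes "finite X" "\<And>g. g \<in> Iso X d \<Longrightarrow> card X \<le> card (Fix X g) + 2"
    and uv: "mutually_nearest u v" and ab: "mutually_nearest a b"
  shows "a \<in> {u, v}"
proof (rule ccontr)
  assume a: "a \<notin> {u, v}"
  define g where "g = Transposition.transpose u v \<circ> Transposition.transpose a b"
  \<comment> \<open>The pairs may share the point \<open>b\<close>, so \<open>x\<close> is chosen in
    the first pair but outside the second. Then \<open>g\<close> moves \<open>a\<close>,
    \<open>b\<close> and \<open>x\<close>: the inner transposition fixes \<open>x\<close> and the
    outer one fixes \<open>a\<close>.\<close>
  obtain x where x: "x \<in> {u, v}" "x \<noteq> b"
    using uv by (auto simp: mutually_nearest_def)
  have X: "{a, b, x} \<subseteq> X" and ne: "a \<noteq> b" "u \<noteq> v"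
    using uv ab x by (auto simp: mutually_nearest_def)
  have "Fix X g \<subseteq> X - {a, b, x}"
    using a x ne by (auto simp: Fix_def g_def Transposition.transpose_def split: if_splits)
  then have "card (Fix X g) \<le> card (X - {a, b, x})"
    using assms(1) by (intro card_mono) auto
  moreover have "card (X - {a, b, x}) = card X - 3"
    using X ne a x by (subst card_Diff_subset) auto
  \<comment> \<open>Together with the next fact this makes the truncated subtraction
    \<open>card X - 3\<close> exact.\<close>
  moreover have "card {a, b, x} \<le> card X"
    using X assms(1) by (rule card_mono[rotated])
  moreover have "card {a, b, x} = 3"
    using ne a x by auto
  moreover have "g \<in> Iso X d"
    unfolding g_def using uv ab by (intro Iso_comp transpose_in_Iso)
  ultimately show False
    using assms(2)[of g] by linarith
qed

lemma centre_if_Fix_large: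
  assumes "finite X" "card X \<ge> 2" "\<And>g. g \<in> Iso X d \<Longrightarrow> card X \<le> card (Fix X g) + 2"
  shows "\<exists>c\<in>X. inj_on (d c) X"
proof -
  obtain z w where "z \<in> X" "w \<in> X" "z \<noteq> w"
    using card_le_Suc0_iff_eq[OF assms(1)] assms(2) by auto
  \<comment> \<open>The choice is symmetric: either point of the pair can serve as the
    centre.\<close>
  with assms(1) obtain c p where cp: "mutually_nearest c p"
    by (rule mutually_nearest_in_ball)
  have unique: "a \<in> {c, p}" if "mutually_nearest a b" for a b
    using mutually_nearest_unique[OF assms(1,3) cp that] .
  \<comment> \<open>The ball about \<open>z\<close> through \<open>w\<close> contains a mutually
    nearest pair, which can only be \<open>{c, p}\<close>.\<close>
  have nearest: "d z c \<le> d z w" if zw: "z \<in> X" "w \<in> X" "z \<noteq> w" for z w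
  proof -
    obtain u v where uv: "mutually_nearest u v" "d z u \<le> d z w" "d z v \<le> d z w"
      using mutually_nearest_in_ball[OF assms(1) zw] .
    have "u \<in> {c, p}" "v \<in> {c, p}"
      using unique[OF uv(1)] unique[OF mutually_nearest_sym[OF uv(1)]] .
    moreover have "u \<noteq> v"
      using uv(1) by (simp add: mutually_nearest_def)
    ultimately show ?thesis using uv(2,3) by auto
  qed
  have c: "c \<in> X" using cp by (auto simp: mutually_nearest_def)
  have "inj_on (d c) X"
  proof (rule inj_onI, rule ccontr)
    fix z w assume zw: "z \<in> X" "w \<in> X" "d c z = d c w" "z \<noteq> w"
    have "0 < d c x" if "x \<in> X" "x \<noteq> c" for x
      using mdist_pos_less c that by auto
    then have "z \<noteq> c" "w \<noteq> c"
      using zw c mdist_zero[OF c] by (metis less_irrefl)+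
    have "mutually_nearest z w"
    proof -
      \<comment> \<open>Both terms of the maximum are the common distance to \<open>c\<close>, and
        \<open>c\<close> is already a nearest point of \<open>z\<close> and of
        \<open>w\<close>.\<close>
      have "d z w \<le> max (d z c) (d c w)" using ultra[of z w c] zw c by simp
      then have le: "d z w \<le> d z c" "d z w \<le> d w c"
        using zw(3) by (simp_all add: commute)
      have "d z w \<le> d z x" if "x \<in> X" "x \<noteq> z" for x
        using nearest[of z x] le(1) zw(1) that by simp
      moreover have "d z w \<le> d w x" if "x \<in> X" "x \<noteq> w" for x
        using nearest[of w x] le(2) zw(2) that by simp
      ultimately show ?thesis
        using zw unfolding mutually_nearest_def by blast
    qed
    then have "z \<in> {c, p}" "w \<in> {c, p}"
      by (rule unique, rule unique[OF mutually_nearest_sym])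
    with \<open>z \<noteq> c\<close> \<open>w \<noteq> c\<close> zw(4) show False by simp
  qed
  with c show ?thesis by blast
qed

section \<open>From a centre to isometries with few moved points\<close>

text \<open>The point \<open>p\<close> is a nearest neighbour of \<open>c\<close>. The two
  conclusions give the value of the minimum: the inclusion bounds all fixed point sets from below,
  and exchanging \<open>c\<close> and \<open>p\<close> attains the bound.\<close>

lemma centre_Fix:
  assumes "finite X" "card X \<ge> 2" and c: "c \<in> X" and inj: "inj_on (d c) X"
  obtains p where "mutually_nearest c p"
    and "\<And>g. g \<in> Iso X d \<Longrightarrow> X - {c, p} \<subseteq> Fix X g"
proof -
  have "X - {c} \<noteq> {}"
    using assms(1,2) card_mono[of "{c}" X] by auto
  then obtain p where p: "p \<in> X - {c}" "\<And>x. x \<in> X - {c} \<Longrightarrow> d c p \<le> d c x"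
    using ex_is_arg_min_if_finite[of "X - {c}" "d c"] assms(1)
    by (auto simp: is_arg_min_linorder)
  have far: "d c p < d c x" if "x \<in> X" "x \<noteq> c" "x \<noteq> p" for x
  proof -
    have "d c p \<noteq> d c x" using inj_onD[OF inj, of p x] p(1) that by blast
    with p(2)[of x] that show ?thesis by simp
  qed
  have cp: "mutually_nearest c p"
  proof -
    have "d c p \<le> d p w" if "w \<in> X" "w \<noteq> p" for w
    proof (cases "w = c")
      case False
      then have "d w p = d c w"
        using isosceles[of w p c] far[of w] p(1) c that by simp
      with p(2)[of w] False that show ?thesis by (simp add: commute[of p w])
    qed (simp add: commute)
    with p c show ?thesis unfolding mutually_nearest_def by blast
  qed
  \<comment> \<open>By injectivity \<open>x\<close> and \<open>y\<close> have different distances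
    from \<open>c\<close>, so by \<open>isosceles\<close> their distance is the larger of the
    two.\<close>
  have nearest: "d c x \<le> d x y" if "x \<in> X" "y \<in> X" "x \<noteq> y" "x \<noteq> c" for x y
  proof (cases "d c y < d c x")
    case True
    then show ?thesis using isosceles[of x y c] that c by simp
  next
    case False
    moreover have "d c x \<noteq> d c y"
      using inj_onD[OF inj, of x y] that by blast
    ultimately have "d c x < d c y" by simp
    then show ?thesis using isosceles[of y x c] that c by (simp add: commute[of x y])
  qed
  have "g z = z" if g: "g \<in> Iso X d" and z: "z \<in> X" "z \<noteq> c" "z \<noteq> p" for g z
  proof -
    have perm: "g permutes X" and iso: "\<And>x y. x \<in> X \<Longrightarrow> y \<in> X \<Longrightarrow> d (g x) (g y) = d x y"
      using g by (auto simp: Iso_def)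
    have gz: "g z \<in> X" using perm z by (simp add: permutes_in_image)
    \<comment> \<open>Being an isometry onto \<open>X\<close>, \<open>g\<close> carries the lower
      bound \<open>d c z\<close> for distances from \<open>z\<close> to other points over to
      \<open>g z\<close>.\<close>
    have no_closer: "d c z \<le> d (g z) y" if "y \<in> X" "y \<noteq> g z" for y
    proof -
      from perm that(1) obtain x where x: "x \<in> X" "y = g x"
        by (metis image_iff permutes_image)
      with that(2) have "x \<noteq> z" by blast
      with x z nearest[of z x] iso[of z x] show ?thesis by simp
    qed
    \<comment> \<open>Each of \<open>c\<close> and \<open>p\<close> has the other at distance
      \<open>d c p < d c z\<close>, which \<open>no_closer\<close> forbids for
      \<open>g z\<close>.\<close>
    have "g z \<noteq> c"
      using no_closer[of p] far[OF z] p(1) by auto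
    moreover have "g z \<noteq> p"
      using no_closer[of c] far[OF z] c p(1) by (auto simp: commute[of "g z" c])
    ultimately have "d c z \<le> d c (g z)"
      using no_closer[OF c] by (simp add: commute[of c "g z"])
    \<comment> \<open>It is not yet known that \<open>g\<close> fixes \<open>c\<close>, so
      \<open>nearest\<close> is applied to \<open>g z\<close> and \<open>g c\<close>, whose distance
      is \<open>d z c\<close>.\<close>
    moreover have "d c (g z) \<le> d c z"
    proof -
      have "g c \<noteq> g z" using perm z(2) permutes_inj[of g X] by (auto dest: injD)
      moreover have "g c \<in> X" using perm c by (simp add: permutes_in_image)
      ultimately have "d c (g z) \<le> d (g z) (g c)"
        using nearest[of "g z" "g c"] gz \<open>g z \<noteq> c\<close> by simp
      with iso[OF z(1) c] show ?thesis by (simp add: commute[of z c])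
    qed
    ultimately show ?thesis
      using inj_onD[OF inj, of "g z" z] gz z(1) by simp
  qed
  then show thesis
    using that[OF cp] by (simp add: Fix_def subset_iff)
qed

text \<open>From left to right it suffices that the minimum bounds every fixed point count from
  below; from right to left the transposition of \<open>c\<close> and \<open>p\<close> realises
  it.\<close>

lemma class_R_iff_centre:
  assumes "finite X" "card X \<ge> 2"
  shows "(X, d) \<in> class_R \<longleftrightarrow> (\<exists>c\<in>X. inj_on (d c) X)"
proof
  let ?F = "(\<lambda>g. card (Fix X g)) ` Iso X d"
  have fin: "finite ?F"
    using finite_Iso[OF assms(1)] by simp
  {
    assume "(X, d) \<in> class_R"
    then have "int (Min ?F) = int (card X) - 2"
      by (simp add: class_R_def)
    moreover have "Min ?F \<le> card (Fix X g)" if "g \<in> Iso X d" for g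
      using fin that by auto
    ultimately have "card X \<le> card (Fix X g) + 2" if "g \<in> Iso X d" for g
      using that by fastforce
    with assms show "\<exists>c\<in>X. inj_on (d c) X"
      by (rule centre_if_Fix_large)
  next
    assume "\<exists>c\<in>X. inj_on (d c) X"
    then obtain c p where cp: "mutually_nearest c p"
      and Fix: "\<And>g. g \<in> Iso X d \<Longrightarrow> X - {c, p} \<subseteq> Fix X g"
      using centre_Fix[OF assms] by metis
    have card: "card (X - {c, p}) = card X - 2"
      using cp by (subst card_Diff_subset) (auto simp: mutually_nearest_def)
    have "Fix X (Transposition.transpose c p) = X - {c, p}"
      using cp by (auto simp: Fix_def mutually_nearest_def Transposition.transpose_def)
    then have "card X - 2 \<in> ?F"
      using card transpose_in_Iso[OF cp] by (metis image_eqI)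
    moreover have "card X - 2 \<le> m" if "m \<in> ?F" for m
    proof -
      from that obtain g where "g \<in> Iso X d" "m = card (Fix X g)" by auto
      with Fix card show ?thesis
        using card_mono[of "Fix X g" "X - {c, p}"] assms(1) by (simp add: Fix_def)
    qed
    ultimately have "Min ?F = card X - 2"
      using fin by (intro Min_eqI)
    then show "(X, d) \<in> class_R"
      using assms Ultrametric_space_axioms by (simp add: class_R_def)
  }
qed

section \<open>Hamiltonian paths with decreasing weights\<close>

text \<open>In the complete graph distinctness already makes consecutive vertices adjacent. A walk
  is a nonempty list, whence \<open>X \<noteq> {}\<close>.\<close>

lemma hamiltonian_path_complete_graph_on_iff:
  assumes "X \<noteq> {}"
  shows "hamiltonian_path (complete_graph_on X) xs \<longleftrightarrow> distinct xs \<and> set xs = X"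
proof -
  have "set (vwalk_arcs xs) \<subseteq> {(x, y). x \<in> set xs \<and> y \<in> set xs \<and> x \<noteq> y}" if "distinct xs"
    using that by (induction xs rule: vwalk_arcs.induct) auto
  with assms show ?thesis
    by (auto simp: hamiltonian_path_def vpath_def vwalk_def complete_graph_on_def)
qed

text \<open>Lists are indexed from 0, so \<open>k + 2 < card X\<close> ranges over all pairs of
  consecutive edges. The link between path and centre is that each edge is as long as the distance
  from its earlier endpoint to the last vertex.\<close>

lemma decreasing_path_iff_centre:
  assumes "finite X" "X \<noteq> {}"
  shows "(\<exists>xs. distinct xs \<and> set xs = X \<and>
      (\<forall>k. k + 2 < card X \<longrightarrow> d (xs ! k) (xs ! (k + 1)) > d (xs ! (k + 1)) (xs ! (k + 2))))
    \<longleftrightarrow> (\<exists>c\<in>X. inj_on (d c) X)"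
proof
  assume "\<exists>xs. distinct xs \<and> set xs = X \<and>
      (\<forall>k. k + 2 < card X \<longrightarrow> d (xs ! k) (xs ! (k + 1)) > d (xs ! (k + 1)) (xs ! (k + 2)))"
  then obtain xs where xs: "distinct xs" "set xs = X"
    and dec: "\<And>k. k + 2 < card X \<Longrightarrow> d (xs ! k) (xs ! (k + 1)) > d (xs ! (k + 1)) (xs ! (k + 2))"
    by blast
  have len: "length xs = card X" using xs distinct_card by fastforce
  define m where "m = card X - 1"
  have m: "card X = Suc m"
    using assms by (simp add: m_def card_gt_0_iff)
  define c where "c = xs ! m"
  have inX: "xs ! k \<in> X" if "k \<le> m" for k
    using that xs len m by (metis le_imp_less_Suc nth_mem)
  have c: "c \<in> X" using inX by (simp add: c_def)
  have step: "d (xs ! k) c = d (xs ! k) (xs ! Suc k)" if "k < m" for k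
  proof -
    have "k \<le> m" using that by simp
    \<comment> \<open>Induction downwards from the end of the path; the implication makes the base
      case \<open>k = m\<close> vacuous.\<close>
    then have "k < m \<longrightarrow> d (xs ! k) c = d (xs ! k) (xs ! Suc k)"
    proof (induction rule: inc_induct)
      case (step k)
      show ?case
      proof (cases "Suc k < m")
        case True
        \<comment> \<open>By induction the left side is the length of the next edge, which is
          shorter. The triangle is then isosceles with \<open>xs ! Suc k\<close> as the point in the
          role of the centre.\<close>
        have "d (xs ! Suc k) c < d (xs ! Suc k) (xs ! k)"
          using step.IH dec[of k] True m by (simp add: commute)
        then show ?thesis
          using isosceles[of "xs ! k" c "xs ! Suc k"] inX True c by (simp add: commute)
      next
        case False
        then show ?thesis by (metis Suc_lessI c_def)
      qed
    qed simp
    with that show ?thesis by simp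
  qed
  have dec1: "d c (xs ! Suc k) < d c (xs ! k)" if "k < m" for k
  proof (cases "Suc k < m")
    case True
    then show ?thesis using step[of k] step[of "Suc k"] dec[of k] m by (simp add: commute)
  next
    case False
    \<comment> \<open>The last edge has no successor to compare with; here \<open>xs ! Suc k\<close>
      is \<open>c\<close> itself, at distance 0.\<close>
    then have "Suc k = m" using that by simp
    moreover have "xs ! k \<noteq> c"
      using that xs(1) len m by (simp add: c_def nth_eq_iff_index_eq)
    ultimately show ?thesis
      using mdist_pos_less[of c "xs ! k"] c inX[of k] by (simp add: c_def)
  qed
  have dec2: "d c (xs ! l) < d c (xs ! k)" if "k < l" "l \<le> m" for k l
    using that
  proof (induction rule: strict_inc_induct)
    case (base i)
    then show ?case using dec1[of i] by simp
  next
    case (step i)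
    then show ?case using dec1[of i] by simp
  qed
  have "inj_on (d c) X"
  proof (rule inj_onI)
    fix x y assume "x \<in> X" "y \<in> X" and eq: "d c x = d c y"
    then obtain k l where "x = xs ! k" "y = xs ! l" "k \<le> m" "l \<le> m"
      using xs(2) len m by (metis in_set_conv_nth less_Suc_eq_le)
    with eq dec2[of k l] dec2[of l k] show "x = y"
      by (cases k l rule: linorder_cases) auto
  qed
  with c show "\<exists>c\<in>X. inj_on (d c) X" by blast
next
  assume "\<exists>c\<in>X. inj_on (d c) X"
  then obtain c where c: "c \<in> X" and inj: "inj_on (d c) X" by blast
  obtain ys where ys: "set ys = X" "distinct ys"
    using finite_distinct_list[OF assms(1)] by blast
  \<comment> \<open>Decreasing distance from \<open>c\<close>; injectivity makes the order
    strict.\<close>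
  define xs where "xs = rev (sort_key (d c) ys)"
  have xs: "distinct xs" "set xs = X" using ys by (auto simp: xs_def)
  have len: "length xs = card X" using xs distinct_card by fastforce
  have "sorted_wrt (<) (map (d c) (sort_key (d c) ys))"
    using ys inj by (auto simp: strict_sorted_iff distinct_map)
  then have "sorted_wrt (\<lambda>x y. d c y < d c x) xs"
    by (simp add: xs_def sorted_wrt_rev sorted_wrt_map)
  then have dec: "d c (xs ! j) < d c (xs ! i)" if "i < j" "j < card X" for i j
    using that len by (auto simp: sorted_wrt_iff_nth_less)
  \<comment> \<open>Any two vertices are as far apart as the earlier one is from \<open>c\<close>,
    so the edge weights inherit the decrease.\<close>
  have step: "d (xs ! i) (xs ! j) = d c (xs ! i)" if "i < j" "j < card X" for i j
    using isosceles[OF _ _ c dec[OF that]] that len xs(2) by (metis nth_mem order_less_trans)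
  have "d (xs ! k) (xs ! (k + 1)) > d (xs ! (k + 1)) (xs ! (k + 2))" if "k + 2 < card X" for k
    using step[of k "k + 1"] step[of "k + 1" "k + 2"] dec[of k "k + 1"] that by auto
  with xs show "\<exists>xs. distinct xs \<and> set xs = X \<and>
      (\<forall>k. k + 2 < card X \<longrightarrow> d (xs ! k) (xs ! (k + 1)) > d (xs ! (k + 1)) (xs ! (k + 2)))"
    by blast
qed

section \<open>Spanning stars with distinct weights\<close>

lemma spanning_star_iff_centre:
  assumes "finite X" "card X \<ge> 2"
  shows "(\<exists>S (y :: nat \<Rightarrow> 'a). spanning_star S (complete_graph_on X) \<and>
      undirected_edges S = {{y 0, y i} | i. i \<in> {1..card X - 1}} \<and>
      (\<forall>i\<in>{1..card X - 1}. \<forall>j\<in>{1..card X - 1}. i \<noteq> j \<longrightarrow>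
        edge_weight d {y 0, y i} \<noteq> edge_weight d {y 0, y j}))
    \<longleftrightarrow> (\<exists>c\<in>X. inj_on (d c) X)"
proof
  assume "\<exists>S (y :: nat \<Rightarrow> 'a). spanning_star S (complete_graph_on X) \<and>
      undirected_edges S = {{y 0, y i} | i. i \<in> {1..card X - 1}} \<and>
      (\<forall>i\<in>{1..card X - 1}. \<forall>j\<in>{1..card X - 1}. i \<noteq> j \<longrightarrow>
        edge_weight d {y 0, y i} \<noteq> edge_weight d {y 0, y j})"
  then obtain S :: "('a, 'a \<times> 'a) pre_digraph" and y :: "nat \<Rightarrow> 'a"
    where S: "spanning_star S (complete_graph_on X)"
      and edges: "undirected_edges S = {{y 0, y i} | i. i \<in> {1..card X - 1}}"
      and ne: "\<forall>i\<in>{1..card X - 1}. \<forall>j\<in>{1..card X - 1}. i \<noteq> j \<longrightarrow>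
        edge_weight d {y 0, y i} \<noteq> edge_weight d {y 0, y j}"
    by (elim exE conjE) (rule that)
  define c where "c = y 0"
  from S have "verts S = X"
    by (simp add: spanning_star_def spanning_def complete_graph_on_def)
  with S have "\<exists>m\<ge>1. \<exists>U V. X = U \<union> V \<and> U \<inter> V = {} \<and> card U = 1 \<and> card V = m \<and>
      arcs_ends S = U \<times> V \<union> V \<times> U"
    unfolding spanning_star_def star_def complete_bipartite_digraph_def by blast
  then obtain m U V where UV: "m \<ge> 1" "X = U \<union> V" "U \<inter> V = {}" "card U = 1" "card V = m"
      "arcs_ends S = U \<times> V \<union> V \<times> U"
    by blast
  obtain u where u: "U = {u}"
    using UV(4) by (rule card_1_singletonE)
  have "V \<noteq> {}"
    using UV(1,5) by auto
  then obtain v where v: "v \<in> V" by blast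
  have edge_in: "{a, b} \<in> undirected_edges S" if "(a, b) \<in> arcs_ends S" for a b
    unfolding undirected_edges_def using that by (rule rev_image_eqI) simp
  have star_edge: "\<exists>i\<in>{1..card X - 1}. {u, w} = {c, y i}" if "w \<in> V" for w
  proof -
    have "{u, w} \<in> undirected_edges S"
      using that u UV(6) by (intro edge_in) simp
    then show ?thesis unfolding edges c_def by blast
  qed
  have c: "c \<in> X"
    using star_edge[OF v] v u UV(2) by (auto simp: doubleton_eq_iff)
  \<comment> \<open>The vertex \<open>y 0\<close> need not be the singleton side \<open>u\<close> of
    the bipartition, since a star with a single edge can be listed from either end. The case
    \<open>x = u\<close> covers this.\<close>
  have covered: "\<exists>i\<in>{1..card X - 1}. x = y i" if x: "x \<in> X" "x \<noteq> c" for x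
  proof (cases "x = u")
    case True
    with star_edge[OF v] x show ?thesis by (auto simp: doubleton_eq_iff)
  next
    case False
    with x u UV(2) have "x \<in> V" by blast
    with star_edge[of x] x(2) show ?thesis by (auto simp: doubleton_eq_iff)
  qed
  have "d c x \<noteq> d c x'" if x: "x \<in> X" "x' \<in> X" "x \<noteq> x'" "x \<noteq> c" "x' \<noteq> c" for x x'
  proof -
    obtain i j where ij: "i \<in> {1..card X - 1}" "j \<in> {1..card X - 1}" "x = y i" "x' = y j"
      using covered[OF x(1,4)] covered[OF x(2,5)] by blast
    with x(3) have "i \<noteq> j" by blast
    with ne ij have "edge_weight d {c, x} \<noteq> edge_weight d {c, x'}"
      unfolding c_def by blast
    with x(4,5) show ?thesis
      by (simp add: edge_weight_doubleton)
  qed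
  moreover have "d c x \<noteq> d c c" if "x \<in> X" "x \<noteq> c" for x
    using mdist_pos_less[of c x] mdist_zero[OF c] c that by simp
  ultimately have "inj_on (d c) X"
    unfolding inj_on_def by metis
  with c show "\<exists>c\<in>X. inj_on (d c) X" by blast
next
  assume "\<exists>c\<in>X. inj_on (d c) X"
  then obtain c where c: "c \<in> X" and inj: "inj_on (d c) X" by blast
  have "card (X - {c}) = card X - 1" using c by simp
  then obtain h where h: "bij_betw h {1..card X - 1} (X - {c})"
    using ex_bij_betw_nat_finite_1[of "X - {c}"] assms(1) by (metis finite_Diff)
  \<comment> \<open>The index 0 lies outside the domain of the bijection and is free for the
    centre.\<close>
  define y where "y = h(0 := c)"
  have y0: "y 0 = c" by (simp add: y_def)
  have "bij_betw y {1..card X - 1} (X - {c})"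
    using h by (rule bij_betw_cong[THEN iffD1, rotated]) (simp add: y_def)
  then have y_image: "y ` {1..card X - 1} = X - {c}" and y_inj: "inj_on y {1..card X - 1}"
    by (simp_all add: bij_betw_def)
  define S where "S = with_proj \<lparr>pverts = X, parcs = {c} \<times> (X - {c}) \<union> (X - {c}) \<times> {c}\<rparr>"
  have bip: "K\<^bsub>1,card X - 1\<^esub> S"
  proof -
    have "X = {c} \<union> (X - {c}) \<and> {c} \<inter> (X - {c}) = {} \<and> card {c} = 1 \<and>
        card (X - {c}) = card X - 1"
      using c by auto
    then show ?thesis
      unfolding S_def complete_bipartite_digraph_pair_def pair_pre_digraph.simps
      using assms(1) by blast
  qed
  \<comment> \<open>The relation \<open>subgraph\<close> demands that both graphs are well-formed;
    the two interpretations provide this.\<close>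
  interpret S: graph S
    using bip by (simp add: complete_bipartite_digraph_def)
  interpret G: graph "complete_graph_on X"
    using complete_graph_on_complete[OF assms(1)] by (simp add: complete_digraph_def)
  have "subgraph S (complete_graph_on X)"
    unfolding subgraph_def compatible_def
    using c S.wf_digraph_axioms G.wf_digraph_axioms by (auto simp: S_def complete_graph_on_def)
  moreover have "star S"
    unfolding star_def using bip assms(2) by (intro exI[of _ "card X - 1"] conjI) simp_all
  ultimately have "spanning_star S (complete_graph_on X)"
    by (simp add: spanning_star_def spanning_def S_def complete_graph_on_def)
  moreover have "undirected_edges S = {{y 0, y i} | i. i \<in> {1..card X - 1}}"
  proof -
    \<comment> \<open>The two orientations of the arcs yield the same undirected edges.\<close>
    have "(\<lambda>(u, v). {u, v}) ` (A \<times> {c}) = (\<lambda>x. {c, x}) ` A"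
      and "(\<lambda>(u, v). {u, v}) ` ({c} \<times> A) = (\<lambda>x. {c, x}) ` A" for A
      by (auto simp: image_iff doubleton_eq_iff)
    then have "undirected_edges S = (\<lambda>x. {c, x}) ` (X - {c})"
      by (simp add: undirected_edges_def S_def image_Un)
    also have "\<dots> = (\<lambda>i. {c, y i}) ` {1..card X - 1}"
      unfolding y_image[symmetric] image_image ..
    also have "\<dots> = {{y 0, y i} | i. i \<in> {1..card X - 1}}"
      using y0 by auto
    finally show ?thesis .
  qed
  moreover have "\<forall>i\<in>{1..card X - 1}. \<forall>j\<in>{1..card X - 1}. i \<noteq> j \<longrightarrow>
      edge_weight d {y 0, y i} \<noteq> edge_weight d {y 0, y j}"
  proof (intro ballI impI)
    fix i j assume ij: "i \<in> {1..card X - 1}" "j \<in> {1..card X - 1}" "i \<noteq> j"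
    have "y i \<in> X - {c}" "y j \<in> X - {c}" using y_image ij by blast+
    moreover from this have "d c (y i) \<noteq> d c (y j)"
      using inj_onD[OF inj, of "y i" "y j"] inj_onD[OF y_inj, of i j] ij by blast
    ultimately show "edge_weight d {y 0, y i} \<noteq> edge_weight d {y 0, y j}"
      using edge_weight_doubleton[of c "y i"] edge_weight_doubleton[of c "y j"] y0 by auto
  qed
  ultimately show "\<exists>S (y :: nat \<Rightarrow> 'a). spanning_star S (complete_graph_on X) \<and>
      undirected_edges S = {{y 0, y i} | i. i \<in> {1..card X - 1}} \<and>
      (\<forall>i\<in>{1..card X - 1}. \<forall>j\<in>{1..card X - 1}. i \<noteq> j \<longrightarrow>
        edge_weight d {y 0, y i} \<noteq> edge_weight d {y 0, y j})"
    by (intro exI[of _ S] exI[of _ y] conjI)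
qed

end

theorem theorem4p8:
  fixes X :: "'a set" and d :: "'a \<Rightarrow> 'a \<Rightarrow> real" and n :: nat
    and G :: "('a, 'a \<times> 'a) pre_digraph" and \<omega> :: "'a set \<Rightarrow> real"
  assumes "Ultrametric_space X d" and "finite X"
    and "n = card X" and "n \<ge> 2"
    and "G = complete_graph_on X" and "\<omega> = edge_weight d"
  defines "cond_i \<equiv> (X, d) \<in> class_R"
    and "cond_ii \<equiv> \<exists>x :: 'a list. hamiltonian_path G x \<and>
           (\<forall>k. k + 2 < n \<longrightarrow> \<omega> {x ! k, x ! (k + 1)} > \<omega> {x ! (k + 1), x ! (k + 2)})"
    and "cond_iii \<equiv> \<exists>S (y :: nat \<Rightarrow> 'a). spanning_star S G \<and>
           undirected_edges S = {{y 0, y i} | i. i \<in> {1..n - 1}} \<and>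
           (\<forall>i\<in>{1..n - 1}. \<forall>j\<in>{1..n - 1}. i \<noteq> j \<longrightarrow> \<omega> {y 0, y i} \<noteq> \<omega> {y 0, y j})"
  shows "(cond_i \<longleftrightarrow> cond_ii) \<and> (cond_ii \<longleftrightarrow> cond_iii)"
proof -
  interpret Ultrametric_space X d by fact
  have "X \<noteq> {}" using assms(3,4) by auto
  \<comment> \<open>The value of \<open>edge_weight\<close> is determined only on two-element sets,
    so consecutive vertices must first be seen to differ.\<close>
  have weight: "edge_weight d {x ! k, x ! (k + 1)} = d (x ! k) (x ! (k + 1))"
    if "distinct x" "set x = X" "k + 1 < n" for x k
  proof -
    have "length x = n" using that distinct_card assms(3) by fastforce
    with that have "x ! k \<noteq> x ! (k + 1)" by (simp add: nth_eq_iff_index_eq)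
    then show ?thesis by (rule edge_weight_doubleton)
  qed
  have "cond_i \<longleftrightarrow> (\<exists>c\<in>X. inj_on (d c) X)"
    using class_R_iff_centre assms(2-4) by (simp add: cond_i_def)
  moreover have "cond_ii \<longleftrightarrow> (\<exists>xs. distinct xs \<and> set xs = X \<and>
      (\<forall>k. k + 2 < card X \<longrightarrow> d (xs ! k) (xs ! (k + 1)) > d (xs ! (k + 1)) (xs ! (k + 2))))"
  proof -
    have "edge_weight d {x ! k, x ! (k + 1)} > edge_weight d {x ! (k + 1), x ! (k + 2)} \<longleftrightarrow>
        d (x ! k) (x ! (k + 1)) > d (x ! (k + 1)) (x ! (k + 2))"
      if "distinct x" "set x = X" "k + 2 < n" for x k
      using weight[OF that(1,2), of k] weight[OF that(1,2), of "k + 1"] that(3) by simp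
    then show ?thesis
      unfolding cond_ii_def assms(5,6) hamiltonian_path_complete_graph_on_iff[OF \<open>X \<noteq> {}\<close>]
      using assms(3) by blast
  qed
  moreover have "cond_iii \<longleftrightarrow> (\<exists>c\<in>X. inj_on (d c) X)"
    using spanning_star_iff_centre assms(2-4) unfolding cond_iii_def assms(5,6) by simp
  ultimately show ?thesis
    using decreasing_path_iff_centre[OF assms(2) \<open>X \<noteq> {}\<close>] by simp
qed

end
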